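(* Let $C,D\subset\mathbb{R}^2$ be convex bodies such that $D$ is a convex polygon parallel to $C$. Then there exists a constant $\rho(C,D)>0$, depending only on $C$ and $D$, such that for every $n\ge1$ and every packing $S$ of $n$ positive homothets of $C$ in $D$ in which each element of $S$ touches the boundary of $D$, $$\mathrm{per}(S)\le\rho(C,D).$$
   Context: A convex body is a compact convex subset of $\mathbb{R}^2$ with nonempty interior. A positive homothet of $C$ is a set of the form $\mu C + v$ with $\mu>0$ and $v\in\mathbb{R}^2$. A finite set $S=\{C_1,\dots,C_n\}$ of convex bodies is a packing in a convex body $D$ if all $C_i$ are contained in $D$ and the $C_i$ have pairwise disjoint interiors. An element $C_i$ touches the boundary of $D$ if $C_i\cap\partial D\ne\emptyset$. $\mathrm{per}(C)$ denotes the perimeter of a convex body $C$, and $\mathrm{per}(S)=\sum_{i=1}^n\mathrm{per}(C_i)$. Parallel: for a unit direction vector $\mathbf{d}\in\mathbb{S}^1$ and a convex body $K$, the supporting line $\ell_{\mathbf d}(K)$ is the directed line of direction $\mathbf d$ tangent to $K$ such that the closed halfplane on the left of $\ell_{\mathbf d}(K)$ contains $K$. If $\ell_{\mathbf d}(K)\cap K$ is a nondegenerate line segment, it is called a side of $K$. A convex polygon $D$ is parallel to a convex body $C$ if for every direction $\mathbf d\in\mathbb{S}^1$, whenever $\ell_{\mathbf d}(D)\cap D$ is a side of $D$, then $\ell_{\mathbf d}(C)\cap C$ is also a side of $C$. *)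

theory Defs
  imports "HOL-Analysis.Analysis"
begin

definition convex_body :: "(real^2) set \<Rightarrow> bool" where
  "convex_body K \<longleftrightarrow> compact K \<and> convex K \<and> interior K \<noteq> {}"

definition positive_homothet :: "(real^2) set \<Rightarrow> (real^2) set \<Rightarrow> bool" where
  "positive_homothet K C \<longleftrightarrow> (\<exists>\<mu>::real. \<mu> > 0 \<and> (\<exists>v. K = (\<lambda>x. \<mu> *\<^sub>R x + v) ` C))"

text \<open>Bodies with pairwise disjoint interiors are pairwise distinct, since their interiors are
  nonempty; hence a packing of $n$ bodies is a set of cardinality $n$.\<close>

definition packing :: "(real^2) set set \<Rightarrow> (real^2) set \<Rightarrow> bool" where
  "packing S D \<longleftrightarrow> finite S \<and> (\<forall>K\<in>S. convex_body K \<and> K \<subseteq> D) \<and>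
     pairwise (\<lambda>K L. interior K \<inter> interior L = {}) S"

definition touches_boundary :: "(real^2) set \<Rightarrow> (real^2) set \<Rightarrow> bool" where
  "touches_boundary K D \<longleftrightarrow> K \<inter> frontier D \<noteq> {}"


definition curve_length :: "(real \<Rightarrow> 'a::metric_space) \<Rightarrow> ennreal" where
  "curve_length g =
     (SUP ts \<in> {ts. sorted ts \<and> set ts \<subseteq> {0..1}}.
        \<Sum>i<length ts - 1. ennreal (dist (g (ts ! i)) (g (ts ! Suc i))))"

text \<open>The perimeter is the length of the boundary curve. All simple closed parametrizations of
  the boundary have the same length, so the infimum merely selects this common value. With values
  in \<^typ>\<open>ennreal\<close>, a set without a boundary curve of finite length gets perimeter
  \<open>\<infinity>\<close> rather than a spurious finite value.\<close>

definition per :: "(real^2) set \<Rightarrow> ennreal" where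
  "per K =
     (INF g \<in> {g. simple_path g \<and> pathfinish g = pathstart g \<and> path_image g = frontier K}.
        curve_length g)"

definition per_sum :: "(real^2) set set \<Rightarrow> ennreal" where
  "per_sum S = (\<Sum>K\<in>S. per K)"


definition directed_line :: "real^2 \<Rightarrow> real^2 \<Rightarrow> (real^2) set" where
  "directed_line d p = {p + t *\<^sub>R d | t::real. True}"

definition left_normal :: "real^2 \<Rightarrow> real^2" where
  "left_normal d = vector [- (d $ 2), d $ 1]"

definition left_halfplane :: "real^2 \<Rightarrow> real^2 \<Rightarrow> (real^2) set" where
  "left_halfplane d p = {x. left_normal d \<bullet> (x - p) \<ge> 0}"

definition supporting_line :: "real^2 \<Rightarrow> (real^2) set \<Rightarrow> (real^2) set" where
  "supporting_line d K =
     (THE l. \<exists>p\<in>K. l = directed_line d p \<and> K \<subseteq> left_halfplane d p)"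

lemma directed_line_eq:
  assumes "norm d = 1"
  shows "directed_line d p = {x. left_normal d \<bullet> (x - p) = 0}"
proof -
  have d: "(d $ 1)\<^sup>2 + (d $ 2)\<^sup>2 = 1"
    using assms by (simp add: norm_eq_1 inner_vec_def sum_2 power2_eq_square)
  have "\<exists>t. x = p + t *\<^sub>R d" if "left_normal d \<bullet> (x - p) = 0" for x
  proof (intro exI)
    define a b where "a = x $ 1 - p $ 1" and "b = x $ 2 - p $ 2"
    have ab: "d $ 1 * b = d $ 2 * a"
      using that by (simp add: left_normal_def inner_vec_def sum_2 a_def b_def)
    have "(a * d $ 1 + b * d $ 2) * d $ 1 = a * (d $ 1)\<^sup>2 + d $ 2 * (d $ 1 * b)"
      by (simp add: power2_eq_square algebra_simps)
    also have "\<dots> = a * ((d $ 1)\<^sup>2 + (d $ 2)\<^sup>2)"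
      unfolding ab by (simp add: power2_eq_square algebra_simps)
    finally have 1: "(a * d $ 1 + b * d $ 2) * d $ 1 = a"
      using d by simp
    have "(a * d $ 1 + b * d $ 2) * d $ 2 = d $ 1 * (d $ 2 * a) + b * (d $ 2)\<^sup>2"
      by (simp add: power2_eq_square algebra_simps)
    also have "\<dots> = b * ((d $ 1)\<^sup>2 + (d $ 2)\<^sup>2)"
      unfolding ab[symmetric] by (simp add: power2_eq_square algebra_simps)
    finally have 2: "(a * d $ 1 + b * d $ 2) * d $ 2 = b"
      using d by simp
    show "x = p + (a * d $ 1 + b * d $ 2) *\<^sub>R d"
      by (simp add: vec_eq_iff forall_2 1 2) (simp add: a_def b_def)
  qed
  then show ?thesis
    by (auto simp: directed_line_def left_normal_def inner_vec_def sum_2)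
qed

lemma supporting_line_ex1:
  assumes "convex_body K" "norm d = 1"
  shows "\<exists>!l. \<exists>p\<in>K. l = directed_line d p \<and> K \<subseteq> left_halfplane d p"
proof -
  have "compact K" "K \<noteq> {}"
    using assms(1) interior_subset[of K] unfolding convex_body_def by blast+
  moreover have "continuous_on K (\<lambda>x. left_normal d \<bullet> x)"
    by (intro continuous_intros)
  ultimately obtain p where p: "p \<in> K" "\<forall>x\<in>K. left_normal d \<bullet> p \<le> left_normal d \<bullet> x"
    using continuous_attains_inf by blast
  have K: "K \<subseteq> left_halfplane d p"
    using p(2) by (simp add: left_halfplane_def inner_diff_right subset_iff)
  show ?thesis
  proof (rule ex1I)
    show "\<exists>q\<in>K. directed_line d p = directed_line d q \<and> K \<subseteq> left_halfplane d q"
      using p(1) K by blast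
  next
    fix l assume "\<exists>q\<in>K. l = directed_line d q \<and> K \<subseteq> left_halfplane d q"
    then obtain q where q: "q \<in> K" "l = directed_line d q" "K \<subseteq> left_halfplane d q"
      by blast
    have "p \<in> left_halfplane d q"
      using p(1) q(3) by blast
    then have "left_normal d \<bullet> q \<le> left_normal d \<bullet> p"
      by (simp add: left_halfplane_def inner_diff_right)
    moreover have "left_normal d \<bullet> p \<le> left_normal d \<bullet> q"
      using p(2) q(1) by blast
    ultimately have "left_normal d \<bullet> q = left_normal d \<bullet> p"
      by (rule antisym)
    then show "l = directed_line d p"
      by (simp add: q(2) directed_line_eq[OF assms(2)] inner_diff_right)
  qed
qed

definition has_side :: "real^2 \<Rightarrow> (real^2) set \<Rightarrow> bool" where
  "has_side d K \<longleftrightarrow> (\<exists>a b. a \<noteq> b \<and> supporting_line d K \<inter> K = closed_segment a b)"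

definition convex_polygon :: "(real^2) set \<Rightarrow> bool" where
  "convex_polygon D \<longleftrightarrow> polytope D \<and> interior D \<noteq> {}"

definition parallel_to :: "(real^2) set \<Rightarrow> (real^2) set \<Rightarrow> bool" where
  "parallel_to D C \<longleftrightarrow> (\<forall>d. norm d = 1 \<longrightarrow> has_side d D \<longrightarrow> has_side d C)"

end

theory Submission
  imports Defs
begin

text \<open>A homothet \<open>\<mu> C + v\<close> has perimeter at most \<open>\<mu> L\<close>, where \<open>L\<close> is a Lipschitz constant of the
  radial parametrization of the boundary of \<open>C\<close>. If it meets a side \<open>F\<close> of \<open>D\<close>, then by parallelism
  it has on the line of \<open>F\<close> a side of length proportional to \<open>\<mu>\<close>. Sides of distinct members of a
  packing on the same line do not overlap, so the ratios \<open>\<mu>\<close> of the bodies meeting \<open>F\<close> have a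
  bounded sum, and \<open>D\<close> has finitely many sides.\<close>

section \<open>Lipschitz parametrization of the boundary and perimeters of homothets\<close>

lemma curve_length_le_lipschitz:
  assumes "L-lipschitz_on {0..1} g"
  shows "curve_length g \<le> ennreal L"
  unfolding curve_length_def
proof (rule SUP_least)
  fix ts :: "real list"
  assume "ts \<in> {ts. sorted ts \<and> set ts \<subseteq> {0..1}}"
  then have ts: "sorted ts" "\<And>i. i < length ts \<Longrightarrow> ts ! i \<in> {0..1}"
    using nth_mem by blast+
  have L: "0 \<le> L"
    using assms by (simp add: lipschitz_on_def)
  let ?m = "length ts - 1"
  have "dist (g (ts ! i)) (g (ts ! Suc i)) \<le> L * (ts ! Suc i - ts ! i)" if "i < ?m" for i
  proof -
    have "ts ! i \<le> ts ! Suc i"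
      using that ts(1) by (simp add: sorted_nth_mono)
    then show ?thesis
      using lipschitz_onD[OF assms ts(2) ts(2), of i "Suc i"] that by (simp add: dist_real_def)
  qed
  then have "(\<Sum>i<?m. dist (g (ts ! i)) (g (ts ! Suc i))) \<le> (\<Sum>i<?m. L * (ts ! Suc i - ts ! i))"
    by (intro sum_mono) simp
  also have "\<dots> = L * (ts ! ?m - ts ! 0)"
    by (simp add: sum_distrib_left[symmetric] sum_lessThan_telescope)
  also have "\<dots> \<le> L"
  \<comment> \<open>For the empty list the truncated \<open>?m\<close> is 0, so the telescoped
    difference is \<open>ts ! 0 - ts ! 0\<close> and \<open>0 \<le> L\<close> suffices.\<close>
  proof (cases "ts = []")
    case False
    then have "ts ! ?m \<le> 1" "0 \<le> ts ! 0"
      using ts(2)[of ?m] ts(2)[of 0] by auto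
    then have "ts ! ?m - ts ! 0 \<le> 1"
      by simp
    then show ?thesis
      using L by (simp add: mult_left_le)
  qed (use L in simp)
  finally show "(\<Sum>i<?m. ennreal (dist (g (ts ! i)) (g (ts ! Suc i)))) \<le> ennreal L"
    by (simp add: ennreal_leI)
qed

text \<open>If the farther point \<open>a + t v\<close> lies in \<open>C\<close>, the segments joining it to a small ball
  around \<open>a\<close> would cover \<open>a + s u\<close> unless \<open>t - s\<close> is small.\<close>

lemma radial_distance_diff_le:
  fixes a u v :: "'a::euclidean_space"
  assumes "convex C" "ball a r \<subseteq> C" "0 < r"
    and "a + t *\<^sub>R v \<in> C" "a + s *\<^sub>R u \<notin> interior C" "0 < s" "s < t"
  shows "t - s \<le> s * t / r * norm (u - v)"
proof (rule ccontr)
  assume less: "\<not> ?thesis"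
  \<comment> \<open>\<open>w\<close> solves a + s u = (s/t)(a + t v) + (1 - s/t) w, and the negated
    bound puts it at distance less than \<open>r\<close> from \<open>a\<close>.\<close>
  define w where "w = a + (s * t / (t - s)) *\<^sub>R (u - v)"
  have "norm (w - a) = s * t / (t - s) * norm (u - v)"
    using assms by (simp add: w_def)
  also have "\<dots> < r"
    using less assms by (simp add: field_simps)
  finally have "w \<in> ball a r"
    by (simp add: dist_norm norm_minus_commute)
  then have "w \<in> interior C"
    using assms(2) interior_maximal open_ball by blast
  then have "(a + t *\<^sub>R v) - (1 - s / t) *\<^sub>R ((a + t *\<^sub>R v) - w) \<in> interior C"
    using assms by (intro mem_interior_convex_shrink) auto
  also have "(a + t *\<^sub>R v) - (1 - s / t) *\<^sub>R ((a + t *\<^sub>R v) - w) = a + s *\<^sub>R u"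
  proof -
    have "(1 - s / t) * (s * t / (t - s)) = s" "(1 - s / t) * t = t - s"
      using assms by (simp_all add: field_simps)
    moreover have "(a + t *\<^sub>R v) - (1 - s / t) *\<^sub>R ((a + t *\<^sub>R v) - w)
      = a + t *\<^sub>R v - ((1 - s / t) * t) *\<^sub>R v + ((1 - s / t) * (s * t / (t - s))) *\<^sub>R (u - v)"
      by (simp add: w_def algebra_simps)
    ultimately show ?thesis
      by (simp add: algebra_simps)
  qed
  finally show False
    using assms by simp
qed

text \<open>Each coordinate is Lipschitz with constant 2 pi, and the Euclidean norm is at most the
  sum of the absolute coordinates; hence the constant 4 pi.\<close>

lemma lipschitz_unit_circle:
  "(4 * pi)-lipschitz_on UNIV (\<lambda>t. vector [cos (2 * pi * t), sin (2 * pi * t)] :: real^2)"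
proof (rule lipschitz_onI)
  fix x y :: real
  let ?u = "\<lambda>t. vector [cos (2 * pi * t), sin (2 * pi * t)] :: real^2"
  have c: "\<bar>cos (2 * pi * x) - cos (2 * pi * y)\<bar> \<le> 1 * \<bar>2 * pi * x - 2 * pi * y\<bar>"
    using field_differentiable_bound[of UNIV cos "\<lambda>z. - sin z" 1 "2 * pi * x" "2 * pi * y"]
    by (auto intro: DERIV_cos)
  have s: "\<bar>sin (2 * pi * x) - sin (2 * pi * y)\<bar> \<le> 1 * \<bar>2 * pi * x - 2 * pi * y\<bar>"
    using field_differentiable_bound[of UNIV sin cos 1 "2 * pi * x" "2 * pi * y"]
    by (auto intro: DERIV_sin)
  have "2 * pi * x - 2 * pi * y = 2 * pi * (x - y)"
    by (simp add: algebra_simps)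
  then have "\<bar>2 * pi * x - 2 * pi * y\<bar> = 2 * pi * \<bar>x - y\<bar>"
    by (simp add: abs_mult)
  then show "dist (?u x) (?u y) \<le> 4 * pi * dist x y"
    using c s norm_le_l1_cart[of "?u x - ?u y"]
    by (simp add: dist_norm sum_2)
qed simp

text \<open>Parameters of the same point differ by an integer, which on the unit interval is -1, 0
  or 1. The disjunction matches what \<open>loop_free\<close> demands of a closed path.\<close>

lemma unit_circle_eq:
  fixes s t :: real
  assumes "(vector [cos (2 * pi * s), sin (2 * pi * s)] :: real^2) = vector [cos (2 * pi * t), sin (2 * pi * t)]"
    and "s \<in> {0..1}" "t \<in> {0..1}"
  shows "s = t \<or> s = 0 \<and> t = 1 \<or> s = 1 \<and> t = 0"
proof -
  have "sin (2 * pi * s) = sin (2 * pi * t) \<and> cos (2 * pi * s) = cos (2 * pi * t)"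
    using assms(1) by (simp add: vec_eq_iff forall_2)
  then obtain n :: int where "2 * pi * s = 2 * pi * t + 2 * pi * n"
    using sin_cos_eq_iff by blast
  then have "2 * pi * s = 2 * pi * (t + n)"
    by (simp add: algebra_simps)
  then have n: "s = t + n"
    by simp
  then have "real_of_int n \<le> 1" "-1 \<le> real_of_int n"
    using assms(2,3) by auto
  then have "n = 0 \<or> n = 1 \<or> n = -1"
    by linarith
  then show ?thesis
    using n assms(2,3) by auto
qed

text \<open>The unit circle is pushed radially from an interior point onto the frontier. As
  \<open>per\<close> is an infimum over simple closed parametrizations, a single Lipschitz one
  already bounds it from above.\<close>

lemma frontier_lipschitz_loop:
  fixes C :: "(real^2) set"
  assumes "convex_body C"
  obtains g L where "simple_path g" "pathfinish g = pathstart g" "path_image g = frontier C"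
    and "L-lipschitz_on {0..1} g"
proof -
  have C: "compact C" "convex C" "closed C" "bounded C"
    using assms by (auto simp: convex_body_def compact_imp_closed compact_imp_bounded)
  obtain a where a: "a \<in> interior C"
    using assms by (auto simp: convex_body_def)
  then obtain r where r: "0 < r" "ball a r \<subseteq> C"
    by (meson mem_interior)
  obtain R where R: "0 < R" "C \<subseteq> cball a R"
    using bounded_subset_ballD[OF C(4), of a] ball_subset_cball by blast
  have fr: "frontier C \<subseteq> C" "frontier C \<inter> interior C = {}"
    using C(3) by (auto simp: frontier_def)
  have "\<exists>d>0. a + d *\<^sub>R u \<in> frontier C" if "norm u = 1" for u :: "real^2"
    using ray_to_frontier[OF C(4) a, of u] that by force
  then obtain \<rho> where \<rho>: "\<And>u. norm u = 1 \<Longrightarrow> 0 < \<rho> u" "\<And>u. norm u = 1 \<Longrightarrow> a + \<rho> u *\<^sub>R u \<in> frontier C"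
    by metis
  have le_R: "s \<le> R" if "a + s *\<^sub>R u \<in> frontier C" "norm u = 1" for s u
  proof -
    have "a + s *\<^sub>R u \<in> cball a R"
      using that fr(1) R(2) by blast
    then have "\<bar>s\<bar> \<le> R"
      using that(2) by (simp add: dist_norm)
    then show ?thesis
      by simp
  qed
  have less: "t - s \<le> R * R / r * norm (u - v)"
    if "a + s *\<^sub>R u \<in> frontier C" "a + t *\<^sub>R v \<in> frontier C" "norm u = 1" "norm v = 1" "0 < s" "s < t"
    for s t u v
  proof -
    have "t - s \<le> s * t / r * norm (u - v)"
      using that fr r by (intro radial_distance_diff_le[OF C(2) r(2,1)]) auto
    also have "\<dots> \<le> R * R / r * norm (u - v)"
      using that le_R[OF that(1,3)] le_R[OF that(2,4)] r(1)
      by (intro mult_right_mono divide_right_mono mult_mono) auto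
    finally show ?thesis .
  qed
  \<comment> \<open>Stated for arbitrary frontier distances instead of the chosen radii
    \<open>\<rho>\<close>: with \<open>u = v\<close> it also says that a ray from \<open>a\<close>
    meets the frontier only once, which later yields surjectivity.\<close>
  have lip: "\<bar>s - t\<bar> \<le> R * R / r * norm (u - v)"
    if "a + s *\<^sub>R u \<in> frontier C" "a + t *\<^sub>R v \<in> frontier C" "norm u = 1" "norm v = 1" "0 < s" "0 < t"
    for s t u v
    using less[of s u t v] less[of t v s u] that R r
    by (cases s t rule: linorder_cases) (auto simp: norm_minus_commute)
  define h where "h u = a + \<rho> u *\<^sub>R u" for u
  define u where "u t = (vector [cos (2 * pi * t), sin (2 * pi * t)] :: real^2)" for t :: real
  have norm_u: "norm (u t) = 1" for t
    by (simp add: u_def norm_eq_1 inner_vec_def sum_2 flip: power2_eq_square)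
  have "(R * R / r + R)-lipschitz_on {u. norm u = 1} h"
  proof (rule lipschitz_onI)
    fix x y :: "real^2" assume xy: "x \<in> {u. norm u = 1}" "y \<in> {u. norm u = 1}"
    \<comment> \<open>The change of radius at a fixed direction contributes
      \<open>R * R / r\<close>; the change of direction at a radius of at most \<open>R\<close>
      contributes \<open>R\<close>.\<close>
    have "h x - h y = (\<rho> x - \<rho> y) *\<^sub>R x + \<rho> y *\<^sub>R (x - y)"
      by (simp add: h_def algebra_simps)
    then have "norm (h x - h y) \<le> \<bar>\<rho> x - \<rho> y\<bar> + \<rho> y * norm (x - y)"
      using norm_triangle_ineq[of "(\<rho> x - \<rho> y) *\<^sub>R x" "\<rho> y *\<^sub>R (x - y)"] xy \<rho>(1)[of y] by simp
    also have "\<dots> \<le> R * R / r * norm (x - y) + R * norm (x - y)"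
      using xy \<rho> lip le_R[OF \<rho>(2), of y] by (intro add_mono mult_right_mono) auto
    finally show "dist (h x) (h y) \<le> (R * R / r + R) * dist x y"
      by (simp add: dist_norm algebra_simps)
  qed (use R r in auto)
  then have "(R * R / r + R)-lipschitz_on (u ` {0..1}) h"
    by (rule lipschitz_on_subset) (auto simp: norm_u)
  moreover have "(4 * pi)-lipschitz_on {0..1} u"
    using lipschitz_on_subset[OF lipschitz_unit_circle] unfolding u_def by blast
  ultimately have lip_g: "((R * R / r + R) * (4 * pi))-lipschitz_on {0..1} (h \<circ> u)"
    using lipschitz_on_compose by blast
  have inj: "x = y" if "h x = h y" "norm x = 1" "norm y = 1" for x y
  proof -
    have "\<rho> x *\<^sub>R x = \<rho> y *\<^sub>R y"
      using that(1) by (simp add: h_def)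
    moreover from this have "\<rho> x = \<rho> y"
      using \<rho>(1)[OF that(2)] \<rho>(1)[OF that(3)] that(2,3)
      by (metis abs_of_pos mult.right_neutral norm_scaleR)
    ultimately show ?thesis
      using \<rho>(1)[OF that(3)] by simp
  qed
  show thesis
  proof (rule that[OF _ _ _ lip_g])
    show "simple_path (h \<circ> u)"
      unfolding simple_path_def loop_free_def path_def
    proof (intro conjI ballI impI)
      show "continuous_on {0..1} (h \<circ> u)"
        using lip_g lipschitz_on_continuous_on by blast
      fix s t :: real assume "s \<in> {0..1}" "t \<in> {0..1}" "(h \<circ> u) s = (h \<circ> u) t"
      then show "s = t \<or> s = 0 \<and> t = 1 \<or> s = 1 \<and> t = 0"
        using inj[of "u s" "u t"] norm_u unit_circle_eq[of s t] by (auto simp: u_def)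
    qed
    show "pathfinish (h \<circ> u) = pathstart (h \<circ> u)"
      by (simp add: pathfinish_def pathstart_def u_def)
    have "x \<in> (h \<circ> u) ` {0..1}" if x: "x \<in> frontier C" for x
    proof -
      have "x \<noteq> a"
        using a x fr(2) by blast
      define z where "z = (x - a) /\<^sub>R norm (x - a)"
      have z: "norm z = 1" "x = a + norm (x - a) *\<^sub>R z"
        using \<open>x \<noteq> a\<close> by (simp_all add: z_def)
      \<comment> \<open>The right-hand side is zero, so \<open>x\<close> is the frontier point
        chosen on its ray.\<close>
      have "\<bar>norm (x - a) - \<rho> z\<bar> \<le> R * R / r * norm (z - z)"
        using x z \<rho> \<open>x \<noteq> a\<close> by (intro lip) auto
      then have "x = h z"
        using z(2) by (simp add: h_def)
      have "(z $ 1)\<^sup>2 + (z $ 2)\<^sup>2 = 1"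
        using z(1) by (simp add: norm_eq_1 inner_vec_def sum_2 power2_eq_square)
      then obtain t where t: "0 \<le> t" "t \<le> 2 * pi" "z $ 1 = cos t" "z $ 2 = sin t"
        using sincos_total_2pi_le by blast
      have "z = u (t / (2 * pi))"
        using t by (simp add: u_def vec_eq_iff forall_2)
      moreover have "t / (2 * pi) \<in> {0..1}"
        using t by simp
      ultimately show ?thesis
        using \<open>x = h z\<close> by auto
    qed
    then show "path_image (h \<circ> u) = frontier C"
      using \<rho>(2) norm_u by (auto simp: path_image_def h_def)
  qed
qed

lemma frontier_homothet:
  fixes C :: "'a::euclidean_space set"
  assumes "\<mu> > 0"
  shows "frontier ((\<lambda>x. \<mu> *\<^sub>R x + v) ` C) = (\<lambda>x. \<mu> *\<^sub>R x + v) ` frontier C"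
proof -
  have eq: "(\<lambda>x. \<mu> *\<^sub>R x + v) ` X = (+) v ` (*\<^sub>R) \<mu> ` X" for X
    by (auto simp: image_image add.commute)
  have "frontier ((*\<^sub>R) \<mu> ` C) = (*\<^sub>R) \<mu> ` frontier C"
    using assms closure_injective_linear_image[of "(*\<^sub>R) \<mu>" C] interior_injective_linear_image[of "(*\<^sub>R) \<mu>" C]
    by (simp add: frontier_def image_set_diff inj_on_def linear_scaleR)
  then show ?thesis
    by (simp add: eq frontier_translation)
qed

text \<open>One parametrization of the frontier of \<open>C\<close> is carried along by every
  homothety, which multiplies its Lipschitz constant by \<open>\<mu>\<close>. Hence \<open>L\<close>
  can be fixed before \<open>\<mu>\<close> and \<open>v\<close>.\<close>

lemma per_homothet_le:
  fixes C :: "(real^2) set"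
  assumes "convex_body C"
  obtains L where "0 \<le> L" "\<And>\<mu> v. \<mu> > 0 \<Longrightarrow> per ((\<lambda>x. \<mu> *\<^sub>R x + v) ` C) \<le> ennreal (\<mu> * L)"
proof -
  obtain g L where g: "simple_path g" "pathfinish g = pathstart g" "path_image g = frontier C"
    and L: "L-lipschitz_on {0..1} g"
    using frontier_lipschitz_loop[OF assms] .
  have "per ((\<lambda>x. \<mu> *\<^sub>R x + v) ` C) \<le> ennreal (\<mu> * L)" if \<mu>: "\<mu> > 0" for \<mu> v
  proof -
    let ?f = "\<lambda>x. \<mu> *\<^sub>R x + v"
    have "?f \<circ> g = (+) v \<circ> ((*\<^sub>R) \<mu> \<circ> g)"
      by (auto simp: add.commute)
    moreover have "simple_path ((+) v \<circ> ((*\<^sub>R) \<mu> \<circ> g))"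
      unfolding simple_path_translation_eq
      using \<mu> g(1) by (subst simple_path_linear_image_eq) (auto simp: inj_on_def intro: linear_scaleR)
    ultimately have "simple_path (?f \<circ> g)"
      by simp
    moreover have "pathfinish (?f \<circ> g) = pathstart (?f \<circ> g)"
      using g(2) by (simp add: pathfinish_def pathstart_def)
    moreover have "path_image (?f \<circ> g) = frontier (?f ` C)"
      unfolding frontier_homothet[OF \<mu>] g(3)[symmetric] by (simp add: path_image_def image_comp)
    ultimately have "per (?f ` C) \<le> curve_length (?f \<circ> g)"
      unfolding per_def by (intro INF_lower) simp
    also have "(\<mu> * L)-lipschitz_on {0..1} (?f \<circ> g)"
    proof (rule lipschitz_onI)
      fix x y :: real assume "x \<in> {0..1}" "y \<in> {0..1}"
      then have "\<mu> * dist (g x) (g y) \<le> \<mu> * (L * dist x y)"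
        using lipschitz_onD[OF L] \<mu> by (intro mult_left_mono) auto
      moreover have "dist ((?f \<circ> g) x) ((?f \<circ> g) y) = \<mu> * dist (g x) (g y)"
        using \<mu> by (simp add: dist_norm flip: scaleR_diff_right)
      ultimately show "dist ((?f \<circ> g) x) ((?f \<circ> g) y) \<le> \<mu> * L * dist x y"
        by simp
    qed (use \<mu> L in \<open>auto simp: lipschitz_on_def\<close>)
    then have "curve_length (?f \<circ> g) \<le> ennreal (\<mu> * L)"
      by (rule curve_length_le_lipschitz)
    finally show ?thesis .
  qed
  moreover have "0 \<le> L"
    using L by (simp add: lipschitz_on_def)
  ultimately show thesis
    using that by blast
qed

section \<open>Disjointness of sides on a common line\<close>

text \<open>Lebesgue measure is additive on the disjoint union and monotone. Open intervals allow
  neighbouring sides to share an endpoint.\<close>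

lemma sum_disjoint_intervals_le:
  fixes \<alpha> \<beta> :: "'a \<Rightarrow> real"
  assumes "finite S" "\<And>i. i \<in> S \<Longrightarrow> \<alpha> i \<le> \<beta> i" "\<And>i. i \<in> S \<Longrightarrow> {\<alpha> i<..<\<beta> i} \<subseteq> {a..b}" "a \<le> b"
    and "disjoint_family_on (\<lambda>i. {\<alpha> i<..<\<beta> i}) S"
  shows "(\<Sum>i\<in>S. \<beta> i - \<alpha> i) \<le> b - a"
proof -
  have "(\<Sum>i\<in>S. \<beta> i - \<alpha> i) = (\<Sum>i\<in>S. measure lborel {\<alpha> i<..<\<beta> i})"
    using assms(2) by simp
  also have "\<dots> = measure lborel (\<Union>i\<in>S. {\<alpha> i<..<\<beta> i})"
    using assms by (intro measure_finite_Union[symmetric]) auto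
  also have "\<dots> \<le> measure lborel {a..b}"
    using assms by (intro measure_mono_fmeasurable) (auto intro: fmeasurableI)
  finally show ?thesis
    using assms(4) by simp
qed

lemma orthogonal_decomposition_2:
  fixes n e m :: "real^2"
  assumes "n \<noteq> 0" "e \<noteq> 0" "n \<bullet> e = 0"
  obtains c c' where "m = c *\<^sub>R n + c' *\<^sub>R e"
proof -
  have "n \<noteq> e"
    using assms by auto
  have "independent {n, e}"
    using assms by (intro pairwise_orthogonal_independent)
      (auto simp: pairwise_def orthogonal_def inner_commute)
  then have "span {n, e} = UNIV"
    using \<open>n \<noteq> e\<close> card_ge_dim_independent[of "{n, e}" UNIV] by auto
  then have "m \<in> span {n, e}"
    by simp
  then show thesis
    using that by (auto simp: span_insert span_singleton algebra_simps)
qed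

text \<open>Only the interiors are disjoint, so they are separated first; the weak inequalities then
  pass to the closures of the interiors, which contain the bodies.\<close>

lemma convex_body_separation:
  assumes "convex_body K" "convex_body L" "interior K \<inter> interior L = {}"
  obtains m \<gamma> where "m \<noteq> 0" "\<And>x. x \<in> K \<Longrightarrow> m \<bullet> x \<le> \<gamma>" "\<And>x. x \<in> L \<Longrightarrow> \<gamma> \<le> m \<bullet> x"
proof -
  have "convex (interior K)" "convex (interior L)" "interior K \<noteq> {}" "interior L \<noteq> {}"
    using assms by (auto simp: convex_body_def convex_interior)
  then obtain m \<gamma> where m: "m \<noteq> 0" "\<And>x. x \<in> interior K \<Longrightarrow> m \<bullet> x \<le> \<gamma>"
    "\<And>x. x \<in> interior L \<Longrightarrow> \<gamma> \<le> m \<bullet> x"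
    using separating_hyperplane_sets[of "interior K" "interior L"] assms(3) by metis
  have K: "K \<subseteq> closure (interior K)" "L \<subseteq> closure (interior L)"
    using assms closure_subset by (auto simp: convex_body_def convex_closure_interior)
  have "closure (interior K) \<subseteq> {x. m \<bullet> x \<le> \<gamma>}"
    using m by (intro closure_minimal closed_halfspace_le) auto
  moreover have "closure (interior L) \<subseteq> {x. m \<bullet> x \<ge> \<gamma>}"
    using m by (intro closure_minimal closed_halfspace_ge) auto
  ultimately show thesis
    using that m(1) K by blast
qed

lemma convex_body_not_in_line:
  assumes "convex_body K" "n \<noteq> 0" "K \<subseteq> {x. n \<bullet> x = b}"
  shows False
  using interior_mono[OF assms(3)] assms by (simp add: convex_body_def)

text \<open>If the overlap were nonempty, the normal \<open>m\<close> of a line separating the bodies could only be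
  parallel to \<open>n\<close>, so one of them would be squeezed into the line \<open>n \<bullet> x = b\<close>.\<close>

lemma sides_on_line_disjoint:
  fixes K L :: "(real^2) set"
  assumes bodies: "convex_body K" "convex_body L" "interior K \<inter> interior L = {}"
    and n: "n \<noteq> 0" "e \<noteq> 0" "n \<bullet> e = 0"
    and half: "K \<subseteq> {x. n \<bullet> x \<le> b}" "L \<subseteq> {x. n \<bullet> x \<le> b}"
    and on: "p \<in> K" "q \<in> K" "p' \<in> L" "q' \<in> L" "n \<bullet> p = b" "n \<bullet> q = b" "n \<bullet> p' = b" "n \<bullet> q' = b"
  shows "{e \<bullet> p<..<e \<bullet> q} \<inter> {e \<bullet> p'<..<e \<bullet> q'} = {}"
proof (rule ccontr)
  assume "\<not> ?thesis"
  then obtain t where "t \<in> {e \<bullet> p<..<e \<bullet> q}" "t \<in> {e \<bullet> p'<..<e \<bullet> q'}"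
    by blast
  then have t: "e \<bullet> p < t" "t < e \<bullet> q" "e \<bullet> p' < t" "t < e \<bullet> q'"
    by auto
  obtain m \<gamma> where m: "m \<noteq> 0" "\<And>x. x \<in> K \<Longrightarrow> m \<bullet> x \<le> \<gamma>" "\<And>x. x \<in> L \<Longrightarrow> \<gamma> \<le> m \<bullet> x"
    using convex_body_separation[OF bodies] by blast
  obtain c c' where c: "m = c *\<^sub>R n + c' *\<^sub>R e"
    using orthogonal_decomposition_2[OF n] .
  have m_inner: "m \<bullet> x = c * (n \<bullet> x) + c' * (e \<bullet> x)" for x
    by (simp add: c inner_add_left)
  \<comment> \<open>All four points have the same \<open>n\<close>-coordinate, so separation by
    \<open>m\<close> compares only their \<open>e\<close>-coordinates.\<close>
  have le: "c' * (e \<bullet> x) \<le> c' * (e \<bullet> y)" if "x \<in> {p, q}" "y \<in> {p', q'}" for x y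
  proof -
    have "m \<bullet> x \<le> m \<bullet> y" "n \<bullet> x = n \<bullet> y"
      using that m on by force+
    then show ?thesis
      by (simp add: m_inner)
  qed
  \<comment> \<open>Otherwise one of the two intervals would lie entirely before the other, although
    both contain \<open>t\<close>.\<close>
  have "c' = 0"
  proof (cases c' "0::real" rule: linorder_cases)
    case less
    then have "e \<bullet> q' \<le> e \<bullet> p"
      using le[of p q'] by (simp add: mult_le_cancel_left)
    then show ?thesis
      using t by simp
  next
    case greater
    then have "e \<bullet> q \<le> e \<bullet> p'"
      using le[of q p'] by (simp add: mult_le_cancel_left)
    then show ?thesis
      using t by simp
  qed
  then have "c \<noteq> 0" and eq: "\<And>x. m \<bullet> x = c * (n \<bullet> x)"
    using m(1) c m_inner by auto
  \<comment> \<open>\<open>p\<close> in \<open>K\<close> and \<open>p'\<close> in \<open>L\<close>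
    lie on the common line, so they bound \<open>\<gamma>\<close> from both sides by the same
    value.\<close>
  have "\<gamma> = c * b"
    using m(2)[OF on(1)] m(3)[OF on(3)] on eq by simp
  then have KL: "\<And>x. x \<in> K \<Longrightarrow> c * (n \<bullet> x) \<le> c * b" "\<And>x. x \<in> L \<Longrightarrow> c * b \<le> c * (n \<bullet> x)"
    using m eq by auto
  show False
  proof (cases "c > 0")
    case True
    then have "L \<subseteq> {x. n \<bullet> x = b}"
      using KL(2) half(2) by (force intro: antisym)
    then show False
      using convex_body_not_in_line bodies n by blast
  next
    case False
    then have "c < 0"
      using \<open>c \<noteq> 0\<close> by simp
    then have "K \<subseteq> {x. n \<bullet> x = b}"
      using KL(1) half(1) by (force intro: antisym simp: mult_le_cancel_left)
    then show False
      using convex_body_not_in_line bodies n by blast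
  qed
qed

section \<open>Facets of the polygon and parallel sides of the body\<close>

text \<open>Resolves the definite description: any point of support determines the line, as a level
  set of the normal.\<close>

lemma supporting_line_eq:
  assumes "convex_body K" "norm d = 1" "p \<in> K" "K \<subseteq> left_halfplane d p"
  shows "supporting_line d K = {x. left_normal d \<bullet> x = left_normal d \<bullet> p}"
proof -
  have "supporting_line d K = directed_line d p"
    unfolding supporting_line_def
    using supporting_line_ex1[OF assms(1,2)] assms(3,4) by (intro the1_equality) auto
  then show ?thesis
    by (simp add: directed_line_eq[OF assms(2)] inner_diff_right)
qed

text \<open>A facet of a plane polygon is a nondegenerate segment on a supporting line, hence a
  side. Parallelism provides a side of \<open>C\<close> with the same outer normal \<open>n\<close>,
  so \<open>n\<close> is maximal on \<open>C\<close> at \<open>p\<close> and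
  \<open>q\<close>.\<close>

lemma parallel_facet_side:
  assumes "convex_body C" "convex_body D" "polytope D" "parallel_to D C"
    and F: "F facet_of D"
  obtains n b p q where "n \<noteq> 0" "D \<subseteq> {x. n \<bullet> x \<le> b}" "F = D \<inter> {x. n \<bullet> x = b}"
    "p \<in> C" "q \<in> C" "p \<noteq> q" "n \<bullet> p = n \<bullet> q" "\<And>x. x \<in> C \<Longrightarrow> n \<bullet> x \<le> n \<bullet> p"
proof -
  have "polyhedron D"
    using assms(3) by (simp add: polytope_imp_polyhedron)
  then obtain n b where n: "n \<noteq> 0" "D \<subseteq> {x. n \<bullet> x \<le> b}" "F = D \<inter> {x. n \<bullet> x = b}"
    using facet_of_polyhedron F by blast
  have "aff_dim D = 2"
    using aff_dim_nonempty_interior assms(2) by (fastforce simp: convex_body_def)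
  then have dim: "aff_dim F = 1" "F \<noteq> {}" "F face_of D"
    using F by (auto simp: facet_of_def)
  then obtain x y where xy: "F = closed_segment x y"
    using compact_convex_collinear_segment[of F] assms(2)
    by (metis collinear_aff_dim convex_body_def face_of_imp_compact face_of_imp_convex order_refl)
  have "x \<noteq> y"
    using xy dim by auto
  \<comment> \<open>\<open>d\<close> is \<open>n\<close> turned counterclockwise by a right angle
    and normalized, so its left normal is the inner unit normal of \<open>D\<close> along
    \<open>F\<close>.\<close>
  define d :: "real^2" where "d = vector [- n $ 2 / norm n, n $ 1 / norm n]"
  have ln: "left_normal d = (- inverse (norm n)) *\<^sub>R n"
    by (simp add: left_normal_def d_def vec_eq_iff forall_2 field_simps)
  have "d \<bullet> d = (n \<bullet> n) / (norm n)\<^sup>2"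
    by (simp add: d_def inner_vec_def sum_2 power2_eq_square add_divide_distrib)
  then have d: "norm d = 1"
    using n(1) by (simp add: norm_eq_1 power2_norm_eq_inner)
  have ln_eq: "left_normal d \<bullet> u = left_normal d \<bullet> v \<longleftrightarrow> n \<bullet> u = n \<bullet> v" 
    and ln_ge: "left_normal d \<bullet> (u - v) \<ge> 0 \<longleftrightarrow> n \<bullet> u \<le> n \<bullet> v" for u v
    using n(1) by (auto simp: ln inner_diff_right field_simps)
  have "x \<in> F"
    using xy by simp
  then have "supporting_line d D = {u. n \<bullet> u = b}"
    using supporting_line_eq[OF assms(2) d, of x] n by (auto simp: left_halfplane_def ln_eq ln_ge)
  then have "supporting_line d D \<inter> D = closed_segment x y"
    using xy n by auto
  then have "has_side d C"
    using assms(4) d \<open>x \<noteq> y\<close> unfolding parallel_to_def has_side_def by blast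
  then obtain p q where pq: "p \<noteq> q" "supporting_line d C \<inter> C = closed_segment p q"
    unfolding has_side_def by blast
  obtain o' where o': "o' \<in> C" "C \<subseteq> left_halfplane d o'"
    using supporting_line_ex1[OF assms(1) d] by blast
  then have "closed_segment p q = {u. n \<bullet> u = n \<bullet> o'} \<inter> C"
    using supporting_line_eq[OF assms(1) d o'] pq by (simp add: ln_eq)
  then have "n \<bullet> p = n \<bullet> o'" "n \<bullet> q = n \<bullet> o'" "p \<in> C" "q \<in> C"
    using ends_in_segment by blast+
  then show thesis
    using that[OF n _ _ pq(1)] o'(2) by (auto simp: left_halfplane_def ln_ge)
qed

text \<open>Projected to the direction \<open>e\<close> of the side of \<open>C\<close>, the sides
  of the bodies on the line of \<open>F\<close> become disjoint intervals inside the bounded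
  projection of \<open>D\<close>. The bound is fixed before the packing is.\<close>

lemma facet_homothety_sum_bound:
  assumes "convex_body C" "convex_body D" "polytope D" "parallel_to D C"
    and F: "F facet_of D"
  obtains c where "0 \<le> c"
    "\<And>S \<mu> v. packing S D \<Longrightarrow> (\<And>K. K \<in> S \<Longrightarrow> \<mu> K > 0 \<and> K = (\<lambda>x. \<mu> K *\<^sub>R x + v K) ` C \<and> K \<inter> F \<noteq> {})
      \<Longrightarrow> sum \<mu> S \<le> c"
proof -
  obtain n b p q where n: "n \<noteq> 0" "D \<subseteq> {x. n \<bullet> x \<le> b}" "F = D \<inter> {x. n \<bullet> x = b}"
    and pq: "p \<in> C" "q \<in> C" "p \<noteq> q" "n \<bullet> p = n \<bullet> q" and max: "\<And>x. x \<in> C \<Longrightarrow> n \<bullet> x \<le> n \<bullet> p"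
    using parallel_facet_side[OF assms] by blast
  define e where "e = q - p"
  have e: "e \<noteq> 0" "n \<bullet> e = 0"
    using pq by (auto simp: e_def inner_diff_right)
  obtain B where B: "0 < B" "\<And>x. x \<in> D \<Longrightarrow> norm x \<le> B"
    using assms(2) by (metis bounded_pos compact_imp_bounded convex_body_def)
  define M where "M = norm e * B"
  have M: "\<bar>e \<bullet> x\<bar> \<le> M" if "x \<in> D" for x
    using Cauchy_Schwarz_ineq2[of e x] B(2)[OF that] unfolding M_def
    by (meson mult_left_mono norm_ge_zero order_trans)
  have M0: "0 \<le> M"
    using B by (simp add: M_def)
  show thesis
  proof
    show "0 \<le> 2 * M / (e \<bullet> e)"
      using M0 by simp
    fix S \<mu> v
    assume S: "packing S D"
      and K: "\<And>K. K \<in> S \<Longrightarrow> \<mu> K > 0 \<and> K = (\<lambda>x. \<mu> K *\<^sub>R x + v K) ` C \<and> K \<inter> F \<noteq> {}"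
    define P where "P K = \<mu> K *\<^sub>R p + v K" for K
    define Q where "Q K = \<mu> K *\<^sub>R q + v K" for K
    have PQ: "P K \<in> K" "Q K \<in> K" "n \<bullet> P K = b" "n \<bullet> Q K = b" if "K \<in> S" for K
    proof -
      have eqK: "K = (\<lambda>x. \<mu> K *\<^sub>R x + v K) ` C" and pos: "\<mu> K > 0" and meets: "K \<inter> F \<noteq> {}"
        using K[OF that] by auto
      have "P K \<in> (\<lambda>x. \<mu> K *\<^sub>R x + v K) ` C" "Q K \<in> (\<lambda>x. \<mu> K *\<^sub>R x + v K) ` C"
        using pq by (auto simp: P_def Q_def)
      then show in_K: "P K \<in> K" "Q K \<in> K"
        using eqK by simp_all
      obtain z where z: "z \<in> K" "n \<bullet> z = b"
        using meets n(3) by blast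
      have "z \<in> (\<lambda>x. \<mu> K *\<^sub>R x + v K) ` C"
        using z(1) eqK by simp
      then obtain y where y: "y \<in> C" "z = \<mu> K *\<^sub>R y + v K"
        by blast
      \<comment> \<open>\<open>n\<close> is maximal on \<open>C\<close> at \<open>p\<close>, so
        \<open>P K\<close> lies at least as far out as the contact point \<open>z\<close>;
        containment in \<open>D\<close> gives the converse.\<close>
      have "b \<le> n \<bullet> P K"
        using mult_left_mono[OF max[OF y(1)] less_imp_le[OF pos]] z(2)
        by (simp add: P_def y(2) inner_add_right del: mult_le_cancel_left_pos)
      moreover have "n \<bullet> P K \<le> b"
        using in_K that S n(2) by (auto simp: packing_def)
      ultimately show "n \<bullet> P K = b"
        by simp
      then show "n \<bullet> Q K = b"
        using pq(4) by (simp add: P_def Q_def inner_add_right)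
    qed
    \<comment> \<open>Since \<open>e\<close> is not normalized, both the length of the side and the
      homothety contribute, giving the factor \<open>e \<bullet> e\<close> by which the final bound
      is divided.\<close>
    have diff: "e \<bullet> Q K - e \<bullet> P K = \<mu> K * (e \<bullet> e)" for K
      by (simp add: P_def Q_def e_def inner_add_right inner_diff_right algebra_simps)
    have "(\<Sum>K\<in>S. e \<bullet> Q K - e \<bullet> P K) \<le> M - (- M)"
    proof (rule sum_disjoint_intervals_le)
      show "finite S"
        using S by (simp add: packing_def)
      show "e \<bullet> P K \<le> e \<bullet> Q K" if "K \<in> S" for K
        using diff[of K] K[OF that] by (metis diff_ge_0_iff_ge inner_ge_zero less_imp_le mult_nonneg_nonneg)
      show "{e \<bullet> P K<..<e \<bullet> Q K} \<subseteq> {- M..M}" if "K \<in> S" for K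
      proof -
        have "P K \<in> D" "Q K \<in> D"
          using PQ[OF that] that S by (auto simp: packing_def)
        then have "\<bar>e \<bullet> P K\<bar> \<le> M" "\<bar>e \<bullet> Q K\<bar> \<le> M"
          using M by auto
        then show ?thesis
          by auto
      qed
      show "disjoint_family_on (\<lambda>K. {e \<bullet> P K<..<e \<bullet> Q K}) S"
        unfolding disjoint_family_on_def
      proof (intro ballI impI)
        fix K L assume KL: "K \<in> S" "L \<in> S" "K \<noteq> L"
        have "convex_body K" "convex_body L" "interior K \<inter> interior L = {}" "K \<subseteq> D" "L \<subseteq> D"
          using KL S by (auto simp: packing_def pairwise_def)
        then show "{e \<bullet> P K<..<e \<bullet> Q K} \<inter> {e \<bullet> P L<..<e \<bullet> Q L} = {}"
          using PQ[OF KL(1)] PQ[OF KL(2)] n(1,2) e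
          by (intro sides_on_line_disjoint[of K L n e b]) auto
      qed
    qed (use M0 in simp)
    then have "sum \<mu> S * (e \<bullet> e) \<le> 2 * M"
      by (simp add: diff sum_distrib_right)
    then show "sum \<mu> S \<le> 2 * M / (e \<bullet> e)"
      using e by (simp add: pos_le_divide_eq)
  qed
qed

section \<open>Summation over the facets\<close>

theorem proposition3:
  fixes C D :: "(real^2) set"
  assumes "convex_body C" and "convex_body D"
    and "convex_polygon D" and "parallel_to D C"
  shows "\<exists>\<rho>::real. \<rho> > 0 \<and>
    (\<forall>n::nat. n \<ge> 1 \<longrightarrow>
      (\<forall>S. packing S D \<and> card S = n \<and>
           (\<forall>K\<in>S. positive_homothet K C) \<and> (\<forall>K\<in>S. touches_boundary K D) \<longrightarrow>
        per_sum S \<le> ennreal \<rho>))"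
proof -
  have D: "polytope D" "interior D \<noteq> {}"
    using assms(3) by (auto simp: convex_polygon_def)
  define \<F> where "\<F> = {F. F facet_of D}"
  have fin: "finite \<F>"
    using D(1) by (simp add: \<F>_def finite_polyhedron_facets polytope_imp_polyhedron)
  \<comment> \<open>The interior of \<open>D\<close> is nonempty, so its frontier is its relative
    frontier, the union of the facets. Touching the boundary thus means meeting a facet.\<close>
  have fr: "frontier D = \<Union>\<F>"
    using D rel_frontier_of_polyhedron[of D] rel_frontier_nonempty_interior[of D]
    by (simp add: \<F>_def polytope_imp_polyhedron)
  obtain L where L: "0 \<le> L" "\<And>\<mu> v. \<mu> > 0 \<Longrightarrow> per ((\<lambda>x. \<mu> *\<^sub>R x + v) ` C) \<le> ennreal (\<mu> * L)"
    using per_homothet_le[OF assms(1)] by blast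
  have "\<exists>c\<ge>0. \<forall>S \<mu> v. packing S D \<longrightarrow>
      (\<forall>K\<in>S. \<mu> K > 0 \<and> K = (\<lambda>x. \<mu> K *\<^sub>R x + v K) ` C \<and> K \<inter> F \<noteq> {}) \<longrightarrow> sum \<mu> S \<le> c"
    if "F \<in> \<F>" for F
    using facet_homothety_sum_bound[OF assms(1,2) D(1) assms(4), of F] that
    unfolding \<F>_def mem_Collect_eq by metis
  then obtain c where c: "\<And>F. F \<in> \<F> \<Longrightarrow> 0 \<le> c F"
    "\<And>F S \<mu> v. F \<in> \<F> \<Longrightarrow> packing S D \<Longrightarrow>
      (\<forall>K\<in>S. \<mu> K > 0 \<and> K = (\<lambda>x. \<mu> K *\<^sub>R x + v K) ` C \<and> K \<inter> F \<noteq> {}) \<Longrightarrow> sum \<mu> S \<le> c F"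
    by metis
  \<comment> \<open>The summand 1 keeps \<open>\<rho>\<close> positive even if the product
    vanishes.\<close>
  define \<rho> where "\<rho> = sum c \<F> * L + 1"
  have "per_sum S \<le> ennreal \<rho>"
    if S: "packing S D" "\<forall>K\<in>S. positive_homothet K C" "\<forall>K\<in>S. touches_boundary K D" for S
  proof -
    have finS: "finite S"
      using S(1) by (simp add: packing_def)
    obtain \<mu> v where \<mu>: "\<And>K. K \<in> S \<Longrightarrow> \<mu> K > 0" "\<And>K. K \<in> S \<Longrightarrow> K = (\<lambda>x. \<mu> K *\<^sub>R x + v K) ` C"
      using S(2) unfolding positive_homothet_def by metis
    \<comment> \<open>Each body meets at least one facet; one that meets several is counted once for
      each, hence only an inequality.\<close>
    have "sum \<mu> S \<le> (\<Sum>K\<in>S. \<Sum>F\<in>\<F>. if K \<inter> F \<noteq> {} then \<mu> K else 0)"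
    proof (rule sum_mono)
      fix K assume K: "K \<in> S"
      then obtain F where F: "F \<in> \<F>" "K \<inter> F \<noteq> {}"
        using S(3) unfolding touches_boundary_def fr by blast
      have "(\<Sum>F\<in>{F}. if K \<inter> F \<noteq> {} then \<mu> K else 0) \<le> (\<Sum>F\<in>\<F>. if K \<inter> F \<noteq> {} then \<mu> K else 0)"
        using F fin \<mu>(1)[OF K] by (intro sum_mono2) auto
      then show "\<mu> K \<le> (\<Sum>F\<in>\<F>. if K \<inter> F \<noteq> {} then \<mu> K else 0)"
        using F by simp
    qed
    also have "\<dots> = (\<Sum>F\<in>\<F>. \<Sum>K\<in>S. if K \<inter> F \<noteq> {} then \<mu> K else 0)"
      by (rule sum.swap)
    also have "\<dots> = (\<Sum>F\<in>\<F>. sum \<mu> {K\<in>S. K \<inter> F \<noteq> {}})"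
      by (simp only: sum.inter_filter[OF finS])
    also have "\<dots> \<le> sum c \<F>"
    proof (rule sum_mono)
      fix F assume "F \<in> \<F>"
      \<comment> \<open>Subfamilies of a packing are packings, so the facet bound applies to the
        bodies meeting \<open>F\<close>.\<close>
      moreover have "packing {K\<in>S. K \<inter> F \<noteq> {}} D"
        using S(1) by (auto simp: packing_def pairwise_def)
      ultimately show "sum \<mu> {K\<in>S. K \<inter> F \<noteq> {}} \<le> c F"
        using \<mu> by (intro c(2)[where v = v]) auto
    qed
    finally have sum_\<mu>: "sum \<mu> S \<le> sum c \<F>" .
    have "per_sum S \<le> (\<Sum>K\<in>S. ennreal (\<mu> K * L))"
      unfolding per_sum_def
    proof (rule sum_mono)
      fix K assume "K \<in> S"
      then show "per K \<le> ennreal (\<mu> K * L)"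
        using L(2)[of "\<mu> K" "v K"] \<mu>[of K] by simp
    qed
    also have "\<dots> = ennreal (\<Sum>K\<in>S. \<mu> K * L)"
      using \<mu>(1) L(1) by (intro sum_ennreal) (auto simp: less_imp_le)
    also have "\<dots> \<le> ennreal \<rho>"
      using mult_right_mono[OF sum_\<mu> L(1)]
      by (intro ennreal_leI) (simp add: \<rho>_def sum_distrib_right)
    finally show ?thesis .
  qed
  moreover have "\<rho> > 0"
    using c(1) L(1) by (simp add: \<rho>_def sum_nonneg add_nonneg_pos)
  ultimately show ?thesis
    by blast
qed

end
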